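(* Let $p$ be a prime, let $n,m$ be positive integers, and let $A=(A_{ij})_{1\le i,j\le n}\in\mathbb{F}_p^{nm\times nm}$ with blocks $A_{ij}\in\mathbb{F}_p^{m\times m}$. Let $\mathbb{W}$, $d=\dim(\mathbb{W})$ and $Q\in\mathbb{F}_p^{d\times d}$ be as defined in the context. Then the network $x(t+1)=Ax(t)$ over $\mathbb{F}_p$ achieves synchronization if and only if $P_A(\lambda)=\lambda^{nm-d}P_Q(\lambda)$.
   Context: $\mathbb{F}_p$ is the finite field with $p$ elements ($p$ prime), $\mathbf{1}_n$ is the $n$-dimensional all-ones column vector, $\otimes$ is the Kronecker product, and $P_M(\lambda)$ denotes the characteristic polynomial of a square matrix $M$ (for a $0\times0$ matrix it equals $1$). The state is $x(t)=[x_1^{\mathrm T}(t),\dots,x_n^{\mathrm T}(t)]^{\mathrm T}\in\mathbb{F}_p^{nm}$ with $x_i(t)\in\mathbb{F}_p^m$, $t=0,1,2,\dots$. The network $x(t+1)=Ax(t)$ achieves synchronization if for any initial state $x(0)\in\mathbb{F}_p^{nm}$ there exists $T\in\mathbb{N}$ (positive integers) such that $x_1(t)=x_2(t)=\cdots=x_n(t)$ for all $t\ge T$. Let $A_i=A_{i1}+A_{i2}+\cdots+A_{in}\in\mathbb{F}_p^{m\times m}$ for $i=1,\dots,n$. Define $$\mathbb{W}_1=\{\alpha\in\mathbb{F}_p^m \mid (A_i-A_1)A_1^t\alpha=0_m,\ i=2,\dots,n,\ t=0,1,\dots,m-1\},\qquad \mathbb{W}=\{\mathbf{1}_n\otimes\alpha\mid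 \alpha\in\mathbb{W}_1\}.$$ The subspace $\mathbb{W}_1$ is $A_1$-invariant and $\mathbb{W}$ is $A$-invariant. Let $d=\dim(\mathbb{W})=\dim(\mathbb{W}_1)$, let $\alpha_1,\dots,\alpha_d$ be a basis of $\mathbb{W}_1$, and put $\beta_k=\mathbf{1}_n\otimes\alpha_k$ (a basis of $\mathbb{W}$). The matrix $Q\in\mathbb{F}_p^{d\times d}$ is determined by $A_1[\alpha_1,\dots,\alpha_d]=[\alpha_1,\dots,\alpha_d]Q$, or equivalently $A[\beta_1,\dots,\beta_d]=[\beta_1,\dots,\beta_d]Q$. *)

theory Defs
  imports
    "Jordan_Normal_Form.Char_Poly"
    "Jordan_Normal_Form.VS_Connect"
    "Berlekamp_Zassenhaus.Finite_Field"
begin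

(* The field F_p is the type 'p mod_ring with 'p :: prime_card, where p = CARD('p).  As every
   prime is the cardinality of some type, quantifying over 'p amounts to quantifying over p.

   Blocks, agents and entries are numbered from 0: agent i here is agent i + 1 on paper. *)

definition block :: "nat \<Rightarrow> 'a mat \<Rightarrow> nat \<Rightarrow> nat \<Rightarrow> 'a mat" where
  "block m A i j = mat m m (\<lambda>(r, c). A $$ (i * m + r, j * m + c))"

(* A_i = A_i1 + ... + A_in; type mat has no zero, so the sum is taken entrywise. *)
definition block_row_sum :: "nat \<Rightarrow> nat \<Rightarrow> 'a :: comm_monoid_add mat \<Rightarrow> nat \<Rightarrow> 'a mat" where
  "block_row_sum n m A i = mat m m (\<lambda>(r, c). \<Sum>j<n. block m A i j $$ (r, c))"

definition agent :: "nat \<Rightarrow> 'a vec \<Rightarrow> nat \<Rightarrow> 'a vec" where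
  "agent m x i = vec m (\<lambda>r. x $ (i * m + r))"

definition achieves_synchronization :: "nat \<Rightarrow> nat \<Rightarrow> 'a :: semiring_0 mat \<Rightarrow> bool" where
  "achieves_synchronization n m A \<longleftrightarrow>
     (\<forall>x :: nat \<Rightarrow> 'a vec.
        x 0 \<in> carrier_vec (n * m) \<and> (\<forall>t. x (Suc t) = A *\<^sub>v x t) \<longrightarrow>
        (\<exists>T\<ge>1. \<forall>t\<ge>T. \<forall>i<n. \<forall>j<n. agent m (x t) i = agent m (x t) j))"

definition ones_vec :: "nat \<Rightarrow> 'a :: one vec" where
  "ones_vec n = vec n (\<lambda>_. 1)"

definition kron_vec :: "'a :: times vec \<Rightarrow> 'a vec \<Rightarrow> 'a vec" where
  "kron_vec u v =
     vec (dim_vec u * dim_vec v) (\<lambda>k. u $ (k div dim_vec v) * v $ (k mod dim_vec v))"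

definition W1 :: "nat \<Rightarrow> nat \<Rightarrow> 'a :: field mat \<Rightarrow> 'a vec set" where
  "W1 n m A = {\<alpha> \<in> carrier_vec m. \<forall>i\<in>{1..<n}. \<forall>t\<in>{0..m - 1}.
     ((block_row_sum n m A i - block_row_sum n m A 0) * block_row_sum n m A 0 ^\<^sub>m t) *\<^sub>v \<alpha> = 0\<^sub>v m}"

definition W :: "nat \<Rightarrow> nat \<Rightarrow> 'a :: field mat \<Rightarrow> 'a vec set" where
  "W n m A = {kron_vec (ones_vec n) \<alpha> | \<alpha>. \<alpha> \<in> W1 n m A}"

definition subspace_dim :: "nat \<Rightarrow> 'a :: field vec set \<Rightarrow> nat" where
  "subspace_dim N S = vectorspace.dim class_ring ((module_vec TYPE('a) N)\<lparr>carrier := S\<rparr>)"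

definition ordered_basis :: "nat \<Rightarrow> 'a :: field vec set \<Rightarrow> 'a vec list \<Rightarrow> bool" where
  "ordered_basis N S vs \<longleftrightarrow>
     distinct vs \<and>
     vectorspace.basis class_ring ((module_vec TYPE('a) N)\<lparr>carrier := S\<rparr>) (set vs)"

end

theory Submission
  imports Defs
begin

text \<open>
  If all agents share the state $\alpha$, then after one step agent $i$ has the state $A_i \alpha$. Hence the
  agents agree at present and for ever after exactly if the common state $\alpha$ satisfies
  $A_i A_1^t \alpha = A_1^{t+1} \alpha$ for all $i$ and $t$. By the Cayley--Hamilton theorem it is enough to ask
  this for $t < m$, which is the definition of \<open>W1\<close> (\<open>W1_iff\<close>). So synchronization means that every
  trajectory of $A$ reaches the invariant subspace \<open>W\<close> (\<open>achieves_synchronization_iff\<close>), in other words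
  that the map $D$ induced by $A$ on the quotient $F^{nm} / W$ is nilpotent.

  Extending a basis of \<open>W\<close> to one of the whole space makes $A$ block triangular with diagonal blocks $Q$
  and $D$, so $P_A = P_Q P_D$ (\<open>invariant_subspace_quotient\<close>). Since the monic $P_Q$ can be cancelled, the
  claimed form of $P_A$ says that $P_D(\lambda) = \lambda^{nm-d}$, and this is equivalent to the nilpotency of
  $D$ (\<open>char_poly_X_power_iff_nilpotent\<close>). Both this equivalence and the reduction to $t < m$ rest on
  \<open>cayley_hamilton_functional\<close>.
\<close>


section \<open>Cayley--Hamilton and nilpotent matrices\<close>

text \<open>
  A root of $\lambda^N$ at $0$ belongs to one of the two factors, so one factor $\lambda$ at a time can be cancelled.
\<close>

lemma monic_dvd_X_power:
  fixes p q :: "'a :: field poly"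
  assumes "lead_coeff p = 1" and "p * q = [:0, 1:] ^ N"
  shows "p = [:0, 1:] ^ degree p"
  using assms
proof (induction N arbitrary: p q)
  case 0
  then have "p dvd 1"
    by (metis dvd_triv_left power_0)
  then have "degree p = 0"
    using poly_dvd_1 by blast
  then show ?case
    using 0(1) by (metis degree_eq_zeroE lead_coeff_pCons(2) one_pCons power_0)
next
  case (Suc N)
  have "poly p 0 * poly q 0 = 0"
    using arg_cong[OF Suc.prems(2), of "\<lambda>f. poly f 0"] by simp
  then consider "poly p 0 = 0" | "poly q 0 = 0" by auto
  then show ?case
  proof cases
    case 1
    then obtain p' where p': "p = [:0, 1:] * p'"
      using poly_eq_0_iff_dvd[of p 0] by (auto elim: dvdE)
    then have "p' \<noteq> 0" using Suc.prems(1) by auto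
    have "lead_coeff p' = 1"
      using Suc.prems(1) unfolding p' lead_coeff_mult by simp
    moreover have "p' * q = [:0, 1:] ^ N"
      using Suc.prems(2) unfolding p' by (simp only: power_Suc mult.assoc mult_cancel_left) simp
    ultimately have "p' = [:0, 1:] ^ degree p'" by (rule Suc.IH)
    moreover have "degree p = Suc (degree p')" unfolding p' using \<open>p' \<noteq> 0\<close>
      by (simp add: degree_mult_eq)
    ultimately show ?thesis using p' by (metis power_Suc)
  next
    case 2
    then obtain q' where q': "q = [:0, 1:] * q'"
      using poly_eq_0_iff_dvd[of q 0] by (auto elim: dvdE)
    have "[:0, 1:] * (p * q') = [:0, 1:] * [:0, 1:] ^ N"
      using Suc.prems(2) unfolding q' by (simp only: power_Suc mult.left_commute)
    then have "p * q' = [:0, 1:] ^ N" by (simp only: mult_cancel_left) simp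
    with Suc show ?thesis by blast
  qed
qed

text \<open>
  Comparing the coefficients of $\lambda^i$ in $(\lambda I - A)\,\mathrm{adj}(\lambda I - A) = P_A(\lambda) I$. These
  are the only facts about the adjugate that the Cayley--Hamilton theorem needs.
\<close>

lemma char_poly_matrix_adj_coeff:
  fixes A :: "'a :: comm_ring_1 mat"
  assumes A: "A \<in> carrier_mat n n"
  defines "B \<equiv> (\<lambda>i. map_mat (\<lambda>q. Polynomial.coeff q i) (adj_mat (char_poly_matrix A)))"
  shows "Polynomial.coeff (char_poly A) i \<cdot>\<^sub>m 1\<^sub>m n = (if i = 0 then 0\<^sub>m n n else B (i - 1)) - A * B i"
proof -
  let ?C = "char_poly_matrix A"
  let ?B = "adj_mat ?C"
  have C: "?C \<in> carrier_mat n n" using A by simp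
  note adj = adj_mat[OF C]
  have "(?C * ?B) $$ (r, c) = [:0, 1:] * ?B $$ (r, c) - (\<Sum>k<n. [:A $$ (r, k):] * ?B $$ (k, c))"
    if "r < n" "c < n" for r c
  proof -
    have "(?C * ?B) $$ (r, c) = (\<Sum>k<n. ?C $$ (r, k) * ?B $$ (k, c))"
      using that C adj(1) by (simp add: scalar_prod_def lessThan_atLeast0)
    also have "\<dots> = (\<Sum>k<n. (if k = r then [:0, 1:] * ?B $$ (r, c) else 0) - [:A $$ (r, k):] * ?B $$ (k, c))"
      using that A by (intro sum.cong) (auto simp: char_poly_matrix_def algebra_simps)
    also have "\<dots> = [:0, 1:] * ?B $$ (r, c) - (\<Sum>k<n. [:A $$ (r, k):] * ?B $$ (k, c))"
      using that by (simp add: sum_subtractf)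
    finally show ?thesis .
  qed
  then have "Polynomial.coeff ([:0, 1:] * ?B $$ (r, c) - (\<Sum>k<n. [:A $$ (r, k):] * ?B $$ (k, c))) i
      = Polynomial.coeff ((char_poly A \<cdot>\<^sub>m 1\<^sub>m n) $$ (r, c)) i" if "r < n" "c < n" for r c
    using that adj(2) by (simp add: char_poly_def)
  then show ?thesis
    unfolding B_def using A adj(1)
    by (cases i) (force intro!: eq_matI simp: coeff_sum scalar_prod_def lessThan_atLeast0 coeff_pCons)+
qed

lemma mult_mat_zero_vec:
  fixes M :: "'a :: semiring_0 mat"
  assumes "M \<in> carrier_mat nr nc"
  shows "M *\<^sub>v 0\<^sub>v nc = 0\<^sub>v nr"
  using assms by (intro eq_vecI) auto

text \<open>
  The Cayley--Hamilton theorem, tested against a functional $g$ and a vector $w$, so that only scalar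
  sums occur. Multiplying the coefficient identity for $\lambda^i$ by $A^i$ from the left gives
  $p_i A^i = A^i B_{i-1} - A^{i+1} B_i$, and the sum over $i$ telescopes.
\<close>

lemma cayley_hamilton_functional:
  fixes A :: "'a :: comm_ring_1 mat"
  assumes A: "A \<in> carrier_mat n n" and g: "g \<in> carrier_vec n" and w: "w \<in> carrier_vec n"
  shows "(\<Sum>i\<le>n. Polynomial.coeff (char_poly A) i * (g \<bullet> (A ^\<^sub>m i *\<^sub>v w))) = 0"
proof -
  let ?p = "char_poly A"
  let ?adj = "adj_mat (char_poly_matrix A)"
  \<comment> \<open>\<open>B i\<close> is the coefficient of $\lambda^i$ in the adjugate of $\lambda I - A$; \<open>B'\<close> shifts the
    index by one so that a zero coefficient $B_{-1}$ is available.\<close>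
  define B where "B i = map_mat (\<lambda>q. Polynomial.coeff q i) ?adj" for i
  define B' where "B' i = (if i = 0 then 0\<^sub>m n n else B (i - 1))" for i
  define h where "h i = g \<bullet> (A ^\<^sub>m i *\<^sub>v (B' i *\<^sub>v w))" for i
  have adj: "?adj \<in> carrier_mat n n" using adj_mat(1)[of "char_poly_matrix A" n] A by simp
  have B': "B' i \<in> carrier_mat n n" for i using adj by (auto simp: B'_def B_def)
  have pow: "A ^\<^sub>m i \<in> carrier_mat n n" for i using A by simp
  have step: "Polynomial.coeff ?p i * (g \<bullet> (A ^\<^sub>m i *\<^sub>v w)) = h i - h (Suc i)" for i
  proof -
    have scalar: "(a \<cdot>\<^sub>m 1\<^sub>m n) *\<^sub>v w = a \<cdot>\<^sub>v w" for a
      using w by (intro eq_vecI) auto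
    have smult_out: "A ^\<^sub>m i *\<^sub>v (a \<cdot>\<^sub>v w) = a \<cdot>\<^sub>v (A ^\<^sub>m i *\<^sub>v w)" for a
      using w pow[of i] by (intro eq_vecI) auto
    have "Polynomial.coeff ?p i \<cdot>\<^sub>m 1\<^sub>m n = B' i - A * B' (Suc i)"
      using char_poly_matrix_adj_coeff[OF A, of i] by (simp add: B'_def B_def)
    then have "Polynomial.coeff ?p i \<cdot>\<^sub>v w = (B' i - A * B' (Suc i)) *\<^sub>v w"
      using scalar by metis
    also have "\<dots> = B' i *\<^sub>v w - A *\<^sub>v (B' (Suc i) *\<^sub>v w)"
      using A B' w by (simp add: minus_mult_distrib_mat_vec[of _ n n] assoc_mult_mat_vec[of _ n n _ n])
    finally have "A ^\<^sub>m i *\<^sub>v (Polynomial.coeff ?p i \<cdot>\<^sub>v w) =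
        A ^\<^sub>m i *\<^sub>v (B' i *\<^sub>v w) - A ^\<^sub>m i *\<^sub>v (A *\<^sub>v (B' (Suc i) *\<^sub>v w))"
      using mult_minus_distrib_mat_vec[OF pow, of "B' i *\<^sub>v w" "A *\<^sub>v (B' (Suc i) *\<^sub>v w)" i]
        mult_mat_vec_carrier[OF A mult_mat_vec_carrier[OF B' w]] mult_mat_vec_carrier[OF B' w]
      by simp
    also have "A ^\<^sub>m i *\<^sub>v (A *\<^sub>v (B' (Suc i) *\<^sub>v w)) = A ^\<^sub>m Suc i *\<^sub>v (B' (Suc i) *\<^sub>v w)"
      using A B' w pow by (simp add: assoc_mult_mat_vec[OF pow A mult_mat_vec_carrier[OF B' w]])
    finally have "g \<bullet> (A ^\<^sub>m i *\<^sub>v (Polynomial.coeff ?p i \<cdot>\<^sub>v w)) = h i - h (Suc i)"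
      unfolding h_def
      using scalar_prod_minus_distrib[OF g mult_mat_vec_carrier[OF pow mult_mat_vec_carrier[OF B' w]]
          mult_mat_vec_carrier[OF pow mult_mat_vec_carrier[OF B' w]], of i i "Suc i" "Suc i"]
      by (simp del: pow_mat.simps)
    then show ?thesis
      using g smult_out mult_mat_vec_carrier[OF pow w] by simp
  qed
  have "finite ((\<lambda>(i, j). degree (?adj $$ (i, j))) ` ({..<n} \<times> {..<n}))" by simp
  then obtain M where M: "\<And>i j. i < n \<Longrightarrow> j < n \<Longrightarrow> degree (?adj $$ (i, j)) < M"
    unfolding finite_nat_set_iff_bounded by auto
  \<comment> \<open>Summing past the degree of every entry of the adjugate makes both ends of the telescope vanish.\<close>
  have B'_end: "B' (Suc (n + M)) = 0\<^sub>m n n"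
    unfolding B'_def B_def using adj
    by (intro eq_matI) (auto intro!: coeff_eq_0 dest: M simp: trans_less_add2)
  have B'_start: "B' 0 = 0\<^sub>m n n" by (simp add: B'_def)
  have h0: "h 0 = 0" "h (Suc (n + M)) = 0"
  proof -
    have "0\<^sub>m n n *\<^sub>v w = 0\<^sub>v n" using w by (intro eq_vecI) auto
    moreover have "A ^\<^sub>m i *\<^sub>v 0\<^sub>v n = 0\<^sub>v n" for i by (rule mult_mat_zero_vec[OF pow])
    ultimately show "h 0 = 0" "h (Suc (n + M)) = 0"
      using g B'_start B'_end by (simp_all add: h_def del: pow_mat.simps)
  qed
  have "(\<Sum>i\<le>n. Polynomial.coeff ?p i * (g \<bullet> (A ^\<^sub>m i *\<^sub>v w))) =
      (\<Sum>i<Suc (n + M). Polynomial.coeff ?p i * (g \<bullet> (A ^\<^sub>m i *\<^sub>v w)))"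
    using degree_monic_char_poly[OF A]
    by (intro sum.mono_neutral_left) (auto dest!: mult_not_zero intro: le_degree)
  also have "\<dots> = h 0 - h (Suc (n + M))"
    unfolding step by (rule sum_lessThan_telescope')
  finally show ?thesis using h0 by simp
qed

text \<open>
  From left to right this is Cayley--Hamilton. Conversely, $D^t = 0$ gives
  $(\lambda I - D) S = \lambda^t I - D^t = \lambda^t I$ for some polynomial matrix $S$, so $P_D$ is a monic divisor
  of a power of $\lambda$.
\<close>

lemma char_poly_X_power_iff_nilpotent:
  fixes D :: "'a :: field mat"
  assumes D: "D \<in> carrier_mat k k"
  shows "char_poly D = [:0, 1:] ^ k \<longleftrightarrow> (\<exists>t. D ^\<^sub>m t = 0\<^sub>m k k)"
proof
  assume p: "char_poly D = [:0, 1:] ^ k"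
  have coeff_p: "Polynomial.coeff (char_poly D) i = (if i = k then 1 else 0)" for i
    using arg_cong[OF monom_altdef[of "1 :: 'a" k], of "\<lambda>q. Polynomial.coeff q i"] unfolding p
    by (simp split: if_splits)
  have pow: "D ^\<^sub>m k \<in> carrier_mat k k" using D by simp
  have "D ^\<^sub>m k = 0\<^sub>m k k"
  proof (rule eq_matI)
    fix r c assume rc: "r < dim_row (0\<^sub>m k k :: 'a mat)" "c < dim_col (0\<^sub>m k k :: 'a mat)"
    have "0 = (\<Sum>i\<le>k. Polynomial.coeff (char_poly D) i * (unit_vec k r \<bullet> (D ^\<^sub>m i *\<^sub>v unit_vec k c)))"
      using cayley_hamilton_functional[OF D] by simp
    also have "\<dots> = (\<Sum>i\<le>k. if i = k then unit_vec k r \<bullet> (D ^\<^sub>m i *\<^sub>v unit_vec k c) else 0)"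
      by (intro sum.cong) (auto simp: coeff_p)
    also have "\<dots> = (D ^\<^sub>m k) $$ (r, c)"
      using rc D pow scalar_prod_left_unit[OF mult_mat_vec_carrier[OF pow unit_vec_carrier]]
      by (simp del: mult_mat_vec_carrier)
    finally show "(D ^\<^sub>m k) $$ (r, c) = 0\<^sub>m k k $$ (r, c)" using rc by simp
  qed (use pow in auto)
  then show "\<exists>t. D ^\<^sub>m t = 0\<^sub>m k k" ..
next
  assume "\<exists>t. D ^\<^sub>m t = 0\<^sub>m k k"
  then obtain t where t: "D ^\<^sub>m t = 0\<^sub>m k k" ..
  let ?C = "char_poly_matrix D"
  let ?D = "map_mat (\<lambda>a. [:a:]) D"
  let ?X = "[:0, 1:] :: 'a poly"
  have C: "?C \<in> carrier_mat k k" and D': "?D \<in> carrier_mat k k" using D by auto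
  have C_eq: "?C = ?X \<cdot>\<^sub>m 1\<^sub>m k - ?D"
    unfolding char_poly_matrix_def using D by (intro eq_matI) auto
  \<comment> \<open>The factorisation of $\lambda^t - D^t$ by $\lambda - D$ in matrices over polynomials, with the
    cofactor $S_{t+1} = \lambda^t + S_t D$.\<close>
  have "\<exists>S \<in> carrier_mat k k. ?C * S = ?X ^ t \<cdot>\<^sub>m 1\<^sub>m k - map_mat (\<lambda>a. [:a:]) (D ^\<^sub>m t)" for t
  proof (induction t)
    case 0
    have "?C * 0\<^sub>m k k = ?X ^ 0 \<cdot>\<^sub>m 1\<^sub>m k - map_mat (\<lambda>a. [:a:]) (D ^\<^sub>m 0)"
    proof -
      have "map_mat (\<lambda>a. [:a:]) (1\<^sub>m k) = (1\<^sub>m k :: 'a poly mat)"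
        by (intro eq_matI) auto
      moreover have "1 \<cdot>\<^sub>m 1\<^sub>m k - 1\<^sub>m k = (0\<^sub>m k k :: 'a poly mat)"
        by (intro eq_matI) auto
      ultimately show ?thesis using right_mult_zero_mat[OF C] D by simp
    qed
    then show ?case by (metis zero_carrier_mat)
  next
    case (Suc t)
    let ?Dt = "map_mat (\<lambda>a. [:a:]) (D ^\<^sub>m t)"
    from Suc obtain S where S: "S \<in> carrier_mat k k" "?C * S = ?X ^ t \<cdot>\<^sub>m 1\<^sub>m k - ?Dt" by auto
    have Dt: "?Dt \<in> carrier_mat k k" using D by simp
    have pow: "map_mat (\<lambda>a. [:a:]) (D ^\<^sub>m Suc t) = ?Dt * ?D"
      using D by (simp add: map_poly_mult(1)[of _ k k])
    let ?S = "?X ^ t \<cdot>\<^sub>m 1\<^sub>m k + S * ?D"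
    have "?C * ?S = ?C * (?X ^ t \<cdot>\<^sub>m 1\<^sub>m k) + ?C * S * ?D"
      unfolding assoc_mult_mat[OF C S(1) D']
      using C D' S(1) by (intro mult_add_distrib_mat[of _ k k _ k]) auto
    also have "?C * (?X ^ t \<cdot>\<^sub>m 1\<^sub>m k) = ?X ^ t \<cdot>\<^sub>m ?C"
      using C by (subst mult_smult_distrib[of _ k k _ k]) auto
    also have "?C * S * ?D = ?X ^ t \<cdot>\<^sub>m ?D - ?Dt * ?D"
      unfolding S(2) using Dt D'
      by (subst minus_mult_distrib_mat[of _ k k _ _ k]) (auto simp: mult_smult_assoc_mat[of _ k k _ k])
    also have "?X ^ t \<cdot>\<^sub>m ?C + (?X ^ t \<cdot>\<^sub>m ?D - ?Dt * ?D) = ?X ^ Suc t \<cdot>\<^sub>m 1\<^sub>m k - ?Dt * ?D"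
      unfolding C_eq using Dt D'
      by (intro eq_matI) (auto simp: algebra_simps simp del: index_mult_mat(1))
    finally show ?case using C D' S(1) unfolding pow by (intro bexI[of _ ?S]) auto
  qed
  from this[of t] obtain S where S: "S \<in> carrier_mat k k"
    "?C * S = ?X ^ t \<cdot>\<^sub>m 1\<^sub>m k - map_mat (\<lambda>a. [:a:]) (0\<^sub>m k k)" unfolding t by auto
  have CS: "?C * S = ?X ^ t \<cdot>\<^sub>m 1\<^sub>m k"
    unfolding S(2) by (intro eq_matI) auto
  \<comment> \<open>Determinants turn this into a divisor relation for the monic polynomial \<open>char_poly D\<close>.\<close>
  have "char_poly D * det S = ?X ^ (t * k)"
    using arg_cong[OF CS, of det] C S(1)
    by (simp add: char_poly_def det_mult[of _ k] det_smult power_mult)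
  then show "char_poly D = ?X ^ k"
    using monic_dvd_X_power[of "char_poly D" "det S" "t * k"] degree_monic_char_poly[OF D] by simp
qed


section \<open>Orbits of vectors under powers of a matrix\<close>

lemma pow_mat_Suc_mult_vec:
  fixes A :: "'a :: semiring_1 mat"
  assumes A: "A \<in> carrier_mat n n" and x: "x \<in> carrier_vec n"
  shows "A ^\<^sub>m Suc t *\<^sub>v x = A *\<^sub>v (A ^\<^sub>m t *\<^sub>v x)"
  using x
proof (induction t arbitrary: x)
  case 0
  then show ?case using A by simp
next
  case (Suc t)
  have unroll: "A ^\<^sub>m Suc s *\<^sub>v x = A ^\<^sub>m s *\<^sub>v (A *\<^sub>v x)" for s
    by (simp only: pow_mat.simps assoc_mult_mat_vec[OF pow_carrier_mat[OF A] A Suc.prems])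
  have "A ^\<^sub>m Suc (Suc t) *\<^sub>v x = A ^\<^sub>m Suc t *\<^sub>v (A *\<^sub>v x)" by (rule unroll)
  also have "\<dots> = A *\<^sub>v (A ^\<^sub>m t *\<^sub>v (A *\<^sub>v x))"
    by (rule Suc.IH[OF mult_mat_vec_carrier[OF A Suc.prems]])
  finally show ?case by (simp only: unroll)
qed

lemma pow_mat_add_mult_vec:
  fixes A :: "'a :: semiring_1 mat"
  assumes A: "A \<in> carrier_mat n n" and x: "x \<in> carrier_vec n"
  shows "A ^\<^sub>m (s + t) *\<^sub>v x = A ^\<^sub>m s *\<^sub>v (A ^\<^sub>m t *\<^sub>v x)"
proof (induction s)
  case 0
  then show ?case using A mult_mat_vec_carrier[OF pow_carrier_mat[OF A] x] by simp
next
  case (Suc s)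
  have "A ^\<^sub>m t *\<^sub>v x \<in> carrier_vec n" by (rule mult_mat_vec_carrier[OF pow_carrier_mat[OF A] x])
  from pow_mat_Suc_mult_vec[OF A this] pow_mat_Suc_mult_vec[OF A x] Suc
  show ?case by (simp only: add_Suc)
qed

text \<open>
  By Cayley--Hamilton the sequence $g \cdot A^t w$ satisfies a monic linear recurrence of order $n$,
  so it vanishes identically once its first $n$ terms vanish.
\<close>

lemma krylov_functional_zero:
  fixes A :: "'a :: comm_ring_1 mat"
  assumes A: "A \<in> carrier_mat n n" and g: "g \<in> carrier_vec n" and w: "w \<in> carrier_vec n"
    and init: "\<And>t. t < n \<Longrightarrow> g \<bullet> (A ^\<^sub>m t *\<^sub>v w) = 0"
  shows "g \<bullet> (A ^\<^sub>m t *\<^sub>v w) = 0"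
proof (induction t rule: less_induct)
  case (less t)
  show ?case
  proof (cases "t < n")
    case False
    define s where "s = t - n"
    let ?p = "char_poly A"
    have t: "t = n + s" using False by (simp add: s_def)
    have "0 = (\<Sum>i\<le>n. Polynomial.coeff ?p i * (g \<bullet> (A ^\<^sub>m i *\<^sub>v (A ^\<^sub>m s *\<^sub>v w))))"
      using cayley_hamilton_functional[OF A g mult_mat_vec_carrier[OF pow_carrier_mat[OF A] w]] by simp
    also have "\<dots> = (\<Sum>i\<le>n. Polynomial.coeff ?p i * (g \<bullet> (A ^\<^sub>m (i + s) *\<^sub>v w)))"
      by (simp add: pow_mat_add_mult_vec[OF A w])
    also have "\<dots> = (\<Sum>i\<le>n. if i = n then g \<bullet> (A ^\<^sub>m t *\<^sub>v w) else 0)"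
      using less.IH degree_monic_char_poly[OF A] by (intro sum.cong) (auto simp: t)
    finally show ?thesis by simp
  qed (rule init)
qed

text \<open>
  The exponent may depend on the vector because the finitely many unit vectors suffice.
\<close>

lemma nilpotent_iff_kills_each_vector:
  fixes D :: "'a :: comm_semiring_1 mat"
  assumes D: "D \<in> carrier_mat k k"
  shows "(\<exists>t. D ^\<^sub>m t = 0\<^sub>m k k) \<longleftrightarrow> (\<forall>z \<in> carrier_vec k. \<exists>t. D ^\<^sub>m t *\<^sub>v z = 0\<^sub>v k)"
proof
  assume "\<exists>t. D ^\<^sub>m t = 0\<^sub>m k k"
  then obtain t where t: "D ^\<^sub>m t = 0\<^sub>m k k" ..
  have "D ^\<^sub>m t *\<^sub>v z = 0\<^sub>v k" if "z \<in> carrier_vec k" for z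
    unfolding t using that by (intro eq_vecI) auto
  then show "\<forall>z \<in> carrier_vec k. \<exists>t. D ^\<^sub>m t *\<^sub>v z = 0\<^sub>v k" by blast
next
  assume "\<forall>z \<in> carrier_vec k. \<exists>t. D ^\<^sub>m t *\<^sub>v z = 0\<^sub>v k"
  then have "\<forall>j. \<exists>t. D ^\<^sub>m t *\<^sub>v unit_vec k j = 0\<^sub>v k" by simp
  then obtain t where t: "\<And>j. D ^\<^sub>m t j *\<^sub>v unit_vec k j = 0\<^sub>v k" by metis
  \<comment> \<open>Any common upper bound of the finitely many times would do.\<close>
  define T where "T = (\<Sum>j<k. t j)"
  have kill: "D ^\<^sub>m T *\<^sub>v unit_vec k j = 0\<^sub>v k" if "j < k" for j
  proof -
    have "t j \<le> T" unfolding T_def using that by (intro member_le_sum) auto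
    then have "D ^\<^sub>m T *\<^sub>v unit_vec k j = D ^\<^sub>m (T - t j) *\<^sub>v (D ^\<^sub>m t j *\<^sub>v unit_vec k j)"
      using pow_mat_add_mult_vec[OF D unit_vec_carrier, of "T - t j" "t j" j] by simp
    then show ?thesis unfolding t mult_mat_zero_vec[OF pow_carrier_mat[OF D]] .
  qed
  have "D ^\<^sub>m T = 0\<^sub>m k k"
  proof (rule mat_col_eqI)
    fix j assume "j < dim_col (0\<^sub>m k k :: 'a mat)"
    then have j: "j < k" by simp
    have "col (D ^\<^sub>m T) j = col (D ^\<^sub>m T * 1\<^sub>m k) j"
      by (simp only: right_mult_one_mat[OF pow_carrier_mat[OF D]])
    also have "\<dots> = D ^\<^sub>m T *\<^sub>v unit_vec k j"
      using j by (subst col_mult2[OF pow_carrier_mat[OF D] one_carrier_mat]) simp_all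
    finally show "col (D ^\<^sub>m T) j = col (0\<^sub>m k k) j" using kill[OF j] j by simp
  qed (use D in auto)
  then show "\<exists>t. D ^\<^sub>m t = 0\<^sub>m k k" ..
qed

lemma intertwining_pow_mult_vec:
  fixes A :: "'a :: comm_semiring_1 mat"
  assumes A: "A \<in> carrier_mat N N" and D: "D \<in> carrier_mat k k" and S: "S \<in> carrier_mat k N"
    and SA: "S * A = D * S" and x: "x \<in> carrier_vec N"
  shows "S *\<^sub>v (A ^\<^sub>m t *\<^sub>v x) = D ^\<^sub>m t *\<^sub>v (S *\<^sub>v x)"
proof (induction t)
  case 0
  then show ?case using A D S x mult_mat_vec_carrier[OF S x] by simp
next
  case (Suc t)
  let ?y = "A ^\<^sub>m t *\<^sub>v x"
  have y: "?y \<in> carrier_vec N" by (rule mult_mat_vec_carrier[OF pow_carrier_mat[OF A] x])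
  have "S *\<^sub>v (A ^\<^sub>m Suc t *\<^sub>v x) = S *\<^sub>v (A *\<^sub>v ?y)"
    by (simp only: pow_mat_Suc_mult_vec[OF A x])
  also have "\<dots> = D *\<^sub>v (S *\<^sub>v ?y)"
    by (simp only: assoc_mult_mat_vec[OF S A y, symmetric] assoc_mult_mat_vec[OF D S y, symmetric] SA)
  also have "\<dots> = D ^\<^sub>m Suc t *\<^sub>v (S *\<^sub>v x)"
    by (simp only: Suc pow_mat_Suc_mult_vec[OF D mult_mat_vec_carrier[OF S x]])
  finally show ?case .
qed


section \<open>The quotient by an invariant subspace\<close>

lemma char_poly_four_block_zeros:
  fixes A :: "'a :: idom mat"
  assumes A: "A \<in> carrier_mat n n" and B: "B \<in> carrier_mat n m" and D: "D \<in> carrier_mat m m"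
  shows "char_poly (four_block_mat A B (0\<^sub>m m n) D) = char_poly A * char_poly D"
proof -
  have "char_poly_matrix (four_block_mat A B (0\<^sub>m m n) D) =
      four_block_mat (char_poly_matrix A) (map_mat (\<lambda>a. [:- a:]) B) (0\<^sub>m m n) (char_poly_matrix D)"
    unfolding char_poly_matrix_def
    by (rule eq_matI, insert A B D, auto simp: one_poly_def)
  then show ?thesis
    unfolding char_poly_def
    using det_four_block_mat_lower_left_zero[of "char_poly_matrix A" n
        "map_mat (\<lambda>a. [:- a:]) B" m "0\<^sub>m m n" "char_poly_matrix D"] A B D by simp
qed

lemma triple_mat_prod_index:
  fixes X A Y :: "'a :: comm_semiring_0 mat"
  assumes "X \<in> carrier_mat a N" "A \<in> carrier_mat N N" "Y \<in> carrier_mat N b" "i < a" "j < b"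
  shows "(X * A * Y) $$ (i, j) = row X i \<bullet> (A *\<^sub>v col Y j)"
proof -
  have "X * A * Y = X * (A * Y)" using assms by (auto intro: assoc_mult_mat)
  moreover have "col (A * Y) j = A *\<^sub>v col Y j"
    using assms by (intro col_mult2) auto
  ultimately show ?thesis using assms by simp
qed

text \<open>
  The quotient of $F^N$ by the $A$-invariant span of \<open>us\<close>, in coordinates: $S$ is the quotient map,
  $V$ a section of it, and $D$ the map induced by $A$. In a basis $P = (U\;V)$ that extends \<open>us\<close>, the
  matrix $P^{-1} A P$ is block upper triangular with diagonal blocks $Q$ and $D$, which factors the
  characteristic polynomial.
\<close>

lemma invariant_subspace_quotient:
  fixes A Q :: "'a :: field mat"
  assumes A: "A \<in> carrier_mat N N"
    and us: "set us \<subseteq> carrier_vec N" "distinct us"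
    and indep: "\<not> module.lin_dep class_ring (module_vec TYPE('a) N) (set us)"
    and d: "length us = d"
    and Q: "Q \<in> carrier_mat d d"
    and AU: "A * mat_of_cols N us = mat_of_cols N us * Q"
  obtains S V D where
    "S \<in> carrier_mat (N - d) N" "V \<in> carrier_mat N (N - d)" "D \<in> carrier_mat (N - d) (N - d)"
    "S * V = 1\<^sub>m (N - d)" "S * A = D * S"
    "char_poly A = char_poly Q * char_poly D"
    "\<forall>y \<in> carrier_vec N.
       S *\<^sub>v y = 0\<^sub>v (N - d) \<longleftrightarrow> (\<exists>c \<in> carrier_vec d. y = mat_of_cols N us *\<^sub>v c)"
proof -
  interpret vec_space "TYPE('a)" N .
  define k where "k = N - d"
  have card_us: "card (set us) = d" using us(2) d by (simp add: distinct_card)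
  have card_unit: "card (set (unit_vecs N :: 'a vec list)) = N"
    by (simp add: distinct_card unit_vecs_distinct)
  \<comment> \<open>Steinitz exchange with the unit vectors extends \<open>us\<close> to a generating list of length \<open>N\<close>.\<close>
  have "\<exists>C. finite C \<and> C \<subseteq> carrier_vec N \<and> C \<subseteq> span (set (unit_vecs N)) \<and> C \<inter> set us = {} \<and>
      int (card C) \<le> int N - int d \<and>
      span (set us \<union> C) = span (set (unit_vecs N))"
    using replacement[of "set us" "set (unit_vecs N)"] us indep
    by (simp add: card_us card_unit unit_vecs_carrier span_unit_vecs_is_carrier)
  then obtain C where C: "finite C" "C \<subseteq> carrier_vec N" "C \<inter> set us = {}"
    "int (card C) \<le> int N - int d" "span (set us \<union> C) = carrier_vec N"
    unfolding span_unit_vecs_is_carrier by blast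
  obtain cs where cs: "set cs = C" "distinct cs" using finite_distinct_list[OF C(1)] by auto
  define ps where "ps = us @ cs"
  have ps: "set ps \<subseteq> carrier_vec N" "distinct ps" "span (set ps) = carrier_vec N"
    unfolding ps_def using us cs C by auto
  have "N \<le> card (set ps)"
    using gen_ge_dim[of "set ps"] ps dim_is_n by simp
  then have "N \<le> length ps" using ps(2) by (simp add: distinct_card)
  moreover have "length cs = card C" using cs distinct_card by metis
  ultimately have len_cs: "length cs = k" and N: "N = d + k" and len_ps: "length ps = N"
    using C(4) d unfolding k_def ps_def by auto
  define P where "P = mat_of_cols N ps"
  have P: "P \<in> carrier_mat N N" unfolding P_def using len_ps by auto
  have "\<exists>x \<in> carrier_vec N. P *\<^sub>v x = unit_vec N j" for j
  proof -
    have "cols P = ps" unfolding P_def using ps(1) by (intro cols_mat_of_cols)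
    then have "unit_vec N j \<in> col_space P" unfolding col_space_def using ps(3) by simp
    then show ?thesis unfolding col_space_eq[OF P] using P by auto
  qed
  then obtain x where x: "\<And>j. x j \<in> carrier_vec N" "\<And>j. P *\<^sub>v x j = unit_vec N j" by metis
  define R where "R = mat_of_cols N (map x [0..<N])"
  have R: "R \<in> carrier_mat N N" unfolding R_def by auto
  have PR: "P * R = 1\<^sub>m N"
  proof (rule mat_col_eqI)
    fix j assume "j < dim_col (1\<^sub>m N :: 'a mat)"
    then have j: "j < N" by simp
    have "col (P * R) j = P *\<^sub>v col R j" using P R j by (intro col_mult2)
    also have "col R j = x j" unfolding R_def using j x(1) by simp
    finally show "col (P * R) j = col (1\<^sub>m N) j" using x(2) j by simp
  qed (use P R in auto)
  have RP: "R * P = 1\<^sub>m N" by (rule mat_mult_left_right_inverse[OF P R PR])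

  \<comment> \<open>Splitting \<open>P\<close> into columns \<open>(U V)\<close> and its inverse \<open>R\<close> into rows \<open>(T; S)\<close>.\<close>
  define U where "U = mat_of_cols N us"
  define V where "V = mat_of_cols N cs"
  define T where "T = mat d N (\<lambda>(i, j). R $$ (i, j))"
  define S where "S = mat k N (\<lambda>(i, j). R $$ (i + d, j))"
  have U: "U \<in> carrier_mat N d" and V: "V \<in> carrier_mat N k" and T: "T \<in> carrier_mat d N"
    and S: "S \<in> carrier_mat k N"
    unfolding U_def V_def T_def S_def using d len_cs by auto
  have colU: "col U j = col P j" if "j < d" for j
    unfolding U_def P_def ps_def using that d us(1) cs(1) C(2)
    by (subst (1 2) col_mat_of_cols) (auto simp: nth_append)
  have colV: "col V j = col P (j + d)" if "j < k" for j
    unfolding V_def P_def ps_def using that d len_cs us(1) cs(1) C(2)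
    by (subst (1 2) col_mat_of_cols) (auto simp: nth_append)
  have rowT: "row T i = row R i" if "i < d" for i
    unfolding T_def using that R N by (intro eq_vecI) auto
  have rowS: "row S i = row R (i + d)" if "i < k" for i
    unfolding S_def using that R N by (intro eq_vecI) auto
  have RP_index: "row R i \<bullet> col P j = (if i = j then 1 else 0)" if "i < N" "j < N" for i j
    using arg_cong[OF RP, of "\<lambda>M. M $$ (i, j)"] that R P by simp
  have TU: "T * U = 1\<^sub>m d" and SU: "S * U = 0\<^sub>m k d" and SV: "S * V = 1\<^sub>m k"
    using T S U V N by (auto intro!: eq_matI simp: colU colV rowT rowS RP_index)
  have UTVS: "U * T + V * S = 1\<^sub>m N"
  proof (rule eq_matI)
    fix i j assume "i < dim_row (1\<^sub>m N :: 'a mat)" "j < dim_col (1\<^sub>m N :: 'a mat)"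
    then have ij: "i < N" "j < N" by auto
    have PU: "U $$ (i, l) = P $$ (i, l)" if "l < d" for l
      using arg_cong[OF colU[OF that], of "\<lambda>v. v $ i"] that U P ij N by simp
    have PV: "V $$ (i, l) = P $$ (i, l + d)" if "l < k" for l
      using arg_cong[OF colV[OF that], of "\<lambda>v. v $ i"] that V P ij N by simp
    have "(U * T + V * S) $$ (i, j) =
        (\<Sum>l = 0..<d. P $$ (i, l) * R $$ (l, j)) + (\<Sum>l = 0..<k. P $$ (i, l + d) * R $$ (l + d, j))"
      using U T V S ij by (simp add: scalar_prod_def PU PV) (simp add: T_def S_def)
    also have "\<dots> = (\<Sum>l = 0..<N. P $$ (i, l) * R $$ (l, j))"
      using sum.shift_bounds_nat_ivl[of "\<lambda>l. P $$ (i, l) * R $$ (l, j)" 0 d k]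
        sum.atLeastLessThan_concat[of 0 d N "\<lambda>l. P $$ (i, l) * R $$ (l, j)"] N
      by (simp add: add.commute)
    also have "\<dots> = (P * R) $$ (i, j)" using P R ij by (simp add: scalar_prod_def)
    finally show "(U * T + V * S) $$ (i, j) = 1\<^sub>m N $$ (i, j)" unfolding PR .
  qed (use U T V S in auto)

  define D where "D = S * A * V"
  have D: "D \<in> carrier_mat k k" unfolding D_def using S A V by simp
  have AU': "A * U = U * Q" using AU unfolding U_def .
  have TAU: "T * A * U = Q"
  proof -
    have "T * A * U = T * U * Q" using T A U Q AU' by simp
    then show ?thesis using TU Q by simp
  qed
  have SAU: "S * A * U = 0\<^sub>m k d"
  proof -
    have "S * A * U = S * U * Q" using S A U Q AU' by simp
    then show ?thesis using SU Q by simp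
  qed
  have "R * A * P = four_block_mat (T * A * U) (T * A * V) (S * A * U) (S * A * V)"
  proof (rule eq_matI)
    fix i j assume ij: "i < dim_row (four_block_mat (T * A * U) (T * A * V) (S * A * U) (S * A * V))"
      "j < dim_col (four_block_mat (T * A * U) (T * A * V) (S * A * U) (S * A * V))"
    then have ij': "i < N" "j < N" using T S V U N by auto
    have "(R * A * P) $$ (i, j) = row R i \<bullet> (A *\<^sub>v col P j)"
      by (rule triple_mat_prod_index[OF R A P ij'])
    moreover have "i - d < k" if "\<not> i < d" using that ij' N by auto
    moreover have "j - d < k" if "\<not> j < d" using that ij' N by auto
    ultimately show "(R * A * P) $$ (i, j) =
        four_block_mat (T * A * U) (T * A * V) (S * A * U) (S * A * V) $$ (i, j)"
      using ij' N T S U V A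
      by (auto simp: triple_mat_prod_index[OF T A U] triple_mat_prod_index[OF T A V]
          triple_mat_prod_index[OF S A U] triple_mat_prod_index[OF S A V] colU colV rowT rowS
          simp del: index_mult_mat(1) assoc_mult_mat)
  qed (use R P T S U V N in auto)
  then have block: "R * A * P = four_block_mat Q (T * A * V) (0\<^sub>m k d) D"
    unfolding TAU SAU D_def .
  have "similar_mat (R * A * P) A"
    by (rule similar_matI[of _ _ R P N]) (use R A P RP PR in auto)
  then have char: "char_poly A = char_poly Q * char_poly D"
    using char_poly_similar char_poly_four_block_zeros[OF Q _ D, of "T * A * V"] T A V block
    by (metis mult_carrier_mat)
  have SA: "S * A = D * S"
  proof -
    have "S * A = S * A * (U * T + V * S)" unfolding UTVS using S A by simp
    also have "\<dots> = S * A * U * T + S * A * V * S"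
      using S A U T V assoc_mult_mat[of "S * A" k N U d T N] assoc_mult_mat[of "S * A" k N V k S N]
      by (subst mult_add_distrib_mat[of _ k N _ N]) (auto simp del: assoc_mult_mat)
    also have "\<dots> = D * S"
    proof -
      have "D * S \<in> carrier_mat k N" using D S by simp
      then show ?thesis unfolding SAU D_def[symmetric] using T by simp
    qed
    finally show ?thesis .
  qed
  have ker: "S *\<^sub>v y = 0\<^sub>v k \<longleftrightarrow> (\<exists>c \<in> carrier_vec d. y = U *\<^sub>v c)" if y: "y \<in> carrier_vec N" for y
  proof
    assume S0: "S *\<^sub>v y = 0\<^sub>v k"
    have "y = (U * T + V * S) *\<^sub>v y" unfolding UTVS using y by simp
    also have "\<dots> = U *\<^sub>v (T *\<^sub>v y) + V *\<^sub>v (S *\<^sub>v y)"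
      using U T V S y
      by (subst add_mult_distrib_mat_vec[of _ N N]) (auto simp: assoc_mult_mat_vec[of _ N d] assoc_mult_mat_vec[of _ N k])
    also have "\<dots> = U *\<^sub>v (T *\<^sub>v y)"
    proof -
      have "V *\<^sub>v 0\<^sub>v k = 0\<^sub>v N" by (rule mult_mat_zero_vec[OF V])
      moreover have "U *\<^sub>v (T *\<^sub>v y) \<in> carrier_vec N" using U T y by auto
      ultimately show ?thesis unfolding S0 by simp
    qed
    finally show "\<exists>c \<in> carrier_vec d. y = U *\<^sub>v c" using T y by (intro bexI[of _ "T *\<^sub>v y"]) auto
  next
    assume "\<exists>c \<in> carrier_vec d. y = U *\<^sub>v c"
    then obtain c where c: "c \<in> carrier_vec d" "y = U *\<^sub>v c" ..
    have "S *\<^sub>v y = (S * U) *\<^sub>v c" unfolding c(2) using S U c(1) by simp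
    then show "S *\<^sub>v y = 0\<^sub>v k" unfolding SU using c(1) by (auto intro!: eq_vecI)
  qed
  show ?thesis
    by (rule that[of S V D]) (use S V D SV SA char ker in \<open>simp_all add: k_def U_def\<close>)
qed


section \<open>Injective images of subspaces\<close>

lemma mat_of_cols_map_mult_vec:
  fixes E :: "'a :: comm_semiring_0 mat"
  assumes E: "E \<in> carrier_mat N m" and vs: "set vs \<subseteq> carrier_vec m"
  shows "mat_of_cols N (map (\<lambda>v. E *\<^sub>v v) vs) = E * mat_of_cols m vs"
proof (rule mat_col_eqI)
  fix j assume j: "j < dim_col (E * mat_of_cols m vs)"
  then have "j < length vs" by simp
  moreover from this have "vs ! j \<in> carrier_vec m" using vs nth_mem by blast
  ultimately have "col (mat_of_cols m vs) j = vs ! j"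
    "col (mat_of_cols N (map (\<lambda>v. E *\<^sub>v v) vs)) j = E *\<^sub>v vs ! j"
    using E mult_mat_vec_carrier[OF E] by (auto intro!: trans[OF col_mat_of_cols])
  then show "col (mat_of_cols N (map (\<lambda>v. E *\<^sub>v v) vs)) j = col (E * mat_of_cols m vs) j"
    using j by (subst col_mult2[OF E]) auto
qed (use E in auto)

text \<open>
  Dimension counting does the work: the images of the basis vectors span the image of $S$, whose
  dimension is that of $S$ by rank--nullity, so they are as many as the dimension and hence independent.
\<close>

lemma injective_image_of_basis:
  fixes E :: "'a :: field mat"
  assumes E: "E \<in> carrier_mat N m"
    and inj: "inj_on (\<lambda>v. E *\<^sub>v v) (carrier_vec m)"
    and S: "submodule class_ring S (module_vec TYPE('a) m)"
    and basis: "ordered_basis m S vs"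
  shows "set vs \<subseteq> S" "distinct (map (\<lambda>v. E *\<^sub>v v) vs)"
    "\<not> module.lin_dep class_ring (module_vec TYPE('a) N) (set (map (\<lambda>v. E *\<^sub>v v) vs))"
    "subspace_dim N ((\<lambda>v. E *\<^sub>v v) ` S) = length vs"
    "(\<lambda>v. E *\<^sub>v v) ` S = {mat_of_cols N (map (\<lambda>v. E *\<^sub>v v) vs) *\<^sub>v c |c. c \<in> carrier_vec (length vs)}"
proof -
  let ?f = "\<lambda>v. E *\<^sub>v v"
  let ?us = "map ?f vs"
  let ?U = "mat_of_cols N ?us"
  interpret Vm: vec_space "TYPE('a)" m .
  interpret VN: vec_space "TYPE('a)" N .
  have SC: "S \<subseteq> carrier_vec m" using submodule.subset[OF S] by (simp add: module_vec_simps)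
  have S_vs: "vectorspace class_ring (Vm.vs S)"
    by (rule Vm.subspace_is_vs) (simp add: subspace_def S Vm.vectorspace_axioms)
  interpret S: vectorspace class_ring "Vm.vs S" by (rule S_vs)
  have b: "distinct vs" "S.basis (set vs)" using basis unfolding ordered_basis_def by auto
  then show vs: "set vs \<subseteq> S" unfolding S.basis_def by simp
  have span_vs: "Vm.span (set vs) = S"
    using b(2) Vm.span_li_not_depend(1)[OF vs S] unfolding S.basis_def by simp
  interpret f: linear_map class_ring "Vm.vs S" VN.V ?f
    unfolding linear_map_def mod_hom_def mod_hom_axioms_def module_hom_def
    using S_vs VN.vectorspace_axioms S.module_axioms VN.module_axioms E SC
    by (auto simp: module_vec_simps mult_add_distrib_mat_vec[OF E] subset_iff mult_mat_vec[OF E]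
        vectorspace_def)
  have inj_S: "inj_on ?f (carrier (Vm.vs S))" using inj SC inj_on_subset by auto
  show dist: "distinct ?us"
    using b(1) inj vs SC by (auto simp: distinct_map intro: inj_on_subset)
  have dimS: "S.dim = length vs" using S.dim_basis[OF _ b(2)] b(1) distinct_card by auto
  have fin_dim: "S.fin_dim"
    unfolding S.fin_dim_def using b(2) unfolding S.basis_def by auto
  have imT: "f.imT = ?f ` S" unfolding f.im_def by simp
  have "vectorspace.dim class_ring (VN.vs (?f ` S)) = S.dim"
    using f.rank_nullity[OF fin_dim] f.inj_imp_dim_ker0[OF inj_S] unfolding imT by simp
  then show dim: "subspace_dim N (?f ` S) = length vs" unfolding subspace_dim_def dimS .
  have us: "set ?us \<subseteq> carrier_vec N" using E vs SC by auto
  have U_eq: "?U = E * mat_of_cols m vs"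
    using vs SC by (intro mat_of_cols_map_mult_vec[OF E]) blast
  have vs_range: "S = {mat_of_cols m vs *\<^sub>v c |c. c \<in> carrier_vec (length vs)}"
  proof -
    have "Vm.col_space (mat_of_cols m vs) = S"
      unfolding Vm.col_space_def using cols_mat_of_cols[of vs m] vs SC span_vs by auto
    then show ?thesis
      using Vm.col_space_eq[of "mat_of_cols m vs" "length vs"]
        mult_mat_vec_carrier[of "mat_of_cols m vs" m "length vs"] by auto
  qed
  show range: "?f ` S = {?U *\<^sub>v c |c. c \<in> carrier_vec (length vs)}"
  proof -
    have assoc: "E * mat_of_cols m vs *\<^sub>v c = E *\<^sub>v (mat_of_cols m vs *\<^sub>v c)"
      if "c \<in> carrier_vec (length vs)" for c
      by (rule assoc_mult_mat_vec[OF E _ that]) simp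
    show ?thesis
    proof (intro equalityI subsetI)
      fix y assume "y \<in> ?f ` S"
      then obtain v where v: "v \<in> S" "y = E *\<^sub>v v" by (rule imageE)
      then obtain c where c: "c \<in> carrier_vec (length vs)" "v = mat_of_cols m vs *\<^sub>v c"
        using vs_range by blast
      have "y = ?U *\<^sub>v c" unfolding v(2) c(2) U_eq by (rule assoc[OF c(1), symmetric])
      then show "y \<in> {?U *\<^sub>v c |c. c \<in> carrier_vec (length vs)}" using c(1) by blast
    next
      fix y assume "y \<in> {?U *\<^sub>v c |c. c \<in> carrier_vec (length vs)}"
      then obtain c where c: "c \<in> carrier_vec (length vs)" "y = ?U *\<^sub>v c" by blast
      have "y = E *\<^sub>v (mat_of_cols m vs *\<^sub>v c)" unfolding c(2) U_eq by (rule assoc[OF c(1)])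
      moreover have "mat_of_cols m vs *\<^sub>v c \<in> S" using vs_range c(1) by blast
      ultimately show "y \<in> ?f ` S" by (rule image_eqI)
    qed
  qed
  have span_us: "VN.span (set ?us) = ?f ` S"
  proof -
    have U: "?U \<in> carrier_mat N (length vs)" using mat_of_cols_carrier(1)[of N ?us] by simp
    have "VN.span (set ?us) = VN.col_space ?U"
      unfolding VN.col_space_def cols_mat_of_cols[OF us] ..
    also have "\<dots> = {y \<in> carrier_vec N. \<exists>x \<in> carrier_vec (length vs). ?U *\<^sub>v x = y}"
      using VN.col_space_eq[OF U] U by simp
    also have "\<dots> = {?U *\<^sub>v c |c. c \<in> carrier_vec (length vs)}"
      using mult_mat_vec_carrier[OF U] by blast
    finally show ?thesis unfolding range .
  qed
  have sub: "subspace class_ring (?f ` S) VN.V" using f.imT_is_subspace unfolding imT .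
  interpret W: vectorspace class_ring "VN.vs (?f ` S)" by (rule VN.subspace_is_vs[OF sub])
  have sub': "submodule class_ring (?f ` S) VN.V" using sub unfolding subspace_def by simp
  have us_im: "set ?us \<subseteq> ?f ` S" using vs by auto
  have "W.basis (set ?us)"
  proof (rule W.dim_gen_is_basis)
    show "W.gen_set (set ?us)"
      using VN.span_li_not_depend(1)[OF us_im sub'] span_us by simp
    show "card (set ?us) \<le> W.dim"
      using dim dist distinct_card[of ?us] unfolding subspace_dim_def by simp
  qed (use us_im in auto)
  then show "\<not> module.lin_dep class_ring VN.V (set ?us)"
    using VN.span_li_not_depend(2)[OF us_im sub'] unfolding W.basis_def by simp
qed


section \<open>States in which all agents agree\<close>

lemma kron_ones_index:
  assumes "\<alpha> \<in> carrier_vec m" and k: "k < n * m"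
  shows "kron_vec (ones_vec n) (\<alpha> :: 'a :: semiring_1 vec) $ k = \<alpha> $ (k mod m)"
proof -
  have "k div m < n" by (rule less_mult_imp_div_less[OF k])
  then have "ones_vec n $ (k div m) = (1 :: 'a)" unfolding ones_vec_def by (rule index_vec)
  moreover have "dim_vec \<alpha> = m" using assms(1) by simp
  moreover have "dim_vec (ones_vec n :: 'a vec) = n" unfolding ones_vec_def by (rule dim_vec)
  ultimately show ?thesis unfolding kron_vec_def using k by (simp only: index_vec mult_1_left)
qed

lemma kron_ones_carrier:
  "\<alpha> \<in> carrier_vec m \<Longrightarrow> kron_vec (ones_vec n) \<alpha> \<in> carrier_vec (n * m)"
  unfolding kron_vec_def ones_vec_def by (intro carrier_vecI) auto

lemma agent_index_less:
  assumes "i < n" and "r < m"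
  shows "i * m + r < n * (m :: nat)"
proof -
  have "i * m + r < Suc i * m" using assms(2) by simp
  also have "\<dots> \<le> n * m" by (rule mult_le_mono1) (use assms(1) in simp)
  finally show ?thesis .
qed

lemma agent_carrier [simp]: "agent m x i \<in> carrier_vec m"
  by (simp add: agent_def)

lemma agent_kron_ones:
  assumes "\<alpha> \<in> carrier_vec m" "i < n"
  shows "agent m (kron_vec (ones_vec n) (\<alpha> :: 'a :: semiring_1 vec)) i = \<alpha>"
  using assms by (intro eq_vecI) (auto simp: agent_def kron_ones_index agent_index_less)

lemma agents_eqI:
  assumes "x \<in> carrier_vec (n * m)" "y \<in> carrier_vec (n * m)"
    and "\<And>i. i < n \<Longrightarrow> agent m x i = agent m y i"
  shows "x = y"
proof (rule eq_vecI)
  fix k assume "k < dim_vec y"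
  then have k: "k < n * m" using assms(2) by simp
  then have "m > 0" by (cases m) auto
  then have km: "k div m < n" "k mod m < m" using less_mult_imp_div_less[OF k] by simp_all
  show "x $ k = y $ k"
    using arg_cong[OF assms(3)[OF km(1)], of "\<lambda>v. v $ (k mod m)"] km(2) by (simp add: agent_def)
qed (use assms in auto)

lemma agents_agree_iff_kron_ones:
  fixes x :: "'a :: semiring_1 vec"
  assumes x: "x \<in> carrier_vec (n * m)" and n: "n \<ge> 1"
  shows "(\<forall>i<n. \<forall>j<n. agent m x i = agent m x j) \<longleftrightarrow> (\<exists>\<alpha> \<in> carrier_vec m. x = kron_vec (ones_vec n) \<alpha>)"
proof
  assume agree: "\<forall>i<n. \<forall>j<n. agent m x i = agent m x j"
  have "x = kron_vec (ones_vec n) (agent m x 0)"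
  proof (rule agents_eqI[OF x kron_ones_carrier])
    fix i assume "i < n"
    then show "agent m x i = agent m (kron_vec (ones_vec n) (agent m x 0)) i"
      using agree[rule_format, of i 0] n by (simp add: agent_kron_ones)
  qed simp
  then show "\<exists>\<alpha> \<in> carrier_vec m. x = kron_vec (ones_vec n) \<alpha>"
    by (intro bexI[of _ "agent m x 0"]) auto
qed (auto simp: agent_kron_ones)

text \<open>
  The matrix $\mathbf 1_n \otimes I_m$; it makes \<open>\<alpha> \<mapsto> kron_vec (ones_vec n) \<alpha>\<close> available as a
  matrix-vector product.
\<close>

definition kron_ones_mat :: "nat \<Rightarrow> nat \<Rightarrow> 'a :: zero_neq_one mat" where
  "kron_ones_mat n m = mat (n * m) m (\<lambda>(k, r). if k mod m = r then 1 else 0)"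

lemma kron_ones_mat_mult_vec:
  fixes \<alpha> :: "'a :: semiring_1 vec"
  assumes "\<alpha> \<in> carrier_vec m"
  shows "kron_ones_mat n m *\<^sub>v \<alpha> = kron_vec (ones_vec n) \<alpha>"
proof (rule eq_vecI)
  fix k assume "k < dim_vec (kron_vec (ones_vec n) \<alpha>)"
  then have k: "k < n * m" using kron_ones_carrier[OF assms, of n] by simp
  then have "m > 0" by (cases m) auto
  have "(kron_ones_mat n m *\<^sub>v \<alpha>) $ k = (\<Sum>r = 0..<m. (if k mod m = r then 1 else 0) * \<alpha> $ r)"
    using k assms by (simp add: kron_ones_mat_def scalar_prod_def)
  also have "\<dots> = (\<Sum>r = 0..<m. if k mod m = r then \<alpha> $ r else 0)"
    by (intro sum.cong) auto
  also have "\<dots> = \<alpha> $ (k mod m)" using \<open>m > 0\<close> by simp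
  finally show "(kron_ones_mat n m *\<^sub>v \<alpha>) $ k = kron_vec (ones_vec n) \<alpha> $ k"
    using kron_ones_index[OF assms k] by simp
qed (use kron_ones_carrier[OF assms, of n] in \<open>simp add: kron_ones_mat_def\<close>)

lemma block_row_sum_carrier [simp]: "block_row_sum n m A i \<in> carrier_mat m m"
  by (simp add: block_row_sum_def)

text \<open>
  On a state in which all agents agree, each agent sees only the sum of the blocks in its row.
\<close>

lemma agent_mult_kron_ones:
  fixes A :: "'a :: semiring_1 mat"
  assumes A: "A \<in> carrier_mat (n * m) (n * m)" and \<alpha>: "\<alpha> \<in> carrier_vec m" and i: "i < n"
  shows "agent m (A *\<^sub>v kron_vec (ones_vec n) \<alpha>) i = block_row_sum n m A i *\<^sub>v \<alpha>"
proof (rule eq_vecI)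
  fix r assume "r < dim_vec (block_row_sum n m A i *\<^sub>v \<alpha>)"
  then have r: "r < m" by (simp add: block_row_sum_def)
  note ir = agent_index_less[OF i r]
  let ?k = "kron_vec (ones_vec n) \<alpha>"
  have "agent m (A *\<^sub>v ?k) i $ r = (\<Sum>l<n * m. A $$ (i * m + r, l) * ?k $ l)"
    using A ir r kron_ones_carrier[OF \<alpha>, of n]
    by (simp add: agent_def scalar_prod_def lessThan_atLeast0)
  also have "\<dots> = (\<Sum>j<n. \<Sum>l = m * j..<m * j + m. A $$ (i * m + r, l) * ?k $ l)"
    using sum.nat_group[of "\<lambda>l. A $$ (i * m + r, l) * ?k $ l" m n] by (simp add: mult.commute)
  also have "\<dots> = (\<Sum>j<n. \<Sum>c<m. A $$ (i * m + r, j * m + c) * \<alpha> $ c)"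
  proof (rule sum.cong[OF refl])
    fix j assume "j \<in> {..<n}"
    then have j: "j < n" by simp
    have "(\<Sum>l = m * j..<m * j + m. A $$ (i * m + r, l) * ?k $ l) =
        (\<Sum>c = 0..<m. A $$ (i * m + r, c + m * j) * ?k $ (c + m * j))"
      using sum.shift_bounds_nat_ivl[of "\<lambda>l. A $$ (i * m + r, l) * ?k $ l" 0 "m * j" m]
      by (simp add: add.commute)
    also have "\<dots> = (\<Sum>c<m. A $$ (i * m + r, j * m + c) * \<alpha> $ c)"
    proof (rule sum.cong)
      fix c assume "c \<in> {..<m}"
      then have "?k $ (j * m + c) = \<alpha> $ c"
        using kron_ones_index[OF \<alpha> agent_index_less[OF j]] by simp
      then show "A $$ (i * m + r, c + m * j) * ?k $ (c + m * j) =
          A $$ (i * m + r, j * m + c) * \<alpha> $ c"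
        by (simp add: add.commute mult.commute)
    qed auto
    finally show "(\<Sum>l = m * j..<m * j + m. A $$ (i * m + r, l) * ?k $ l) =
        (\<Sum>c<m. A $$ (i * m + r, j * m + c) * \<alpha> $ c)" .
  qed
  also have "\<dots> = (\<Sum>c<m. (\<Sum>j<n. A $$ (i * m + r, j * m + c)) * \<alpha> $ c)"
    by (subst sum.swap) (simp add: sum_distrib_right)
  also have "\<dots> = (block_row_sum n m A i *\<^sub>v \<alpha>) $ r"
    using r \<alpha> by (simp add: block_row_sum_def block_def scalar_prod_def lessThan_atLeast0)
  finally show "agent m (A *\<^sub>v ?k) i $ r = (block_row_sum n m A i *\<^sub>v \<alpha>) $ r" .
qed (simp add: agent_def block_row_sum_def)

lemma mult_kron_ones:
  fixes A :: "'a :: semiring_1 mat"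
  assumes A: "A \<in> carrier_mat (n * m) (n * m)" and \<alpha>: "\<alpha> \<in> carrier_vec m"
    and same: "\<And>i. i < n \<Longrightarrow> block_row_sum n m A i *\<^sub>v \<alpha> = \<beta>" and \<beta>: "\<beta> \<in> carrier_vec m"
  shows "A *\<^sub>v kron_vec (ones_vec n) \<alpha> = kron_vec (ones_vec n) \<beta>"
  using A \<beta> same kron_ones_carrier[OF \<alpha>, of n]
  by (intro agents_eqI[OF _ kron_ones_carrier[OF \<beta>]])
    (auto simp: agent_mult_kron_ones[OF A \<alpha>] agent_kron_ones)


section \<open>The invariant subspaces\<close>

text \<open>
  The definition of \<open>W1\<close> imposes the conditions for $t < m$ only. Applied to each row of $A_i - A_1$,
  \<open>krylov_functional_zero\<close> extends them to all $t$, and in this form invariance is obvious.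
\<close>

lemma W1_iff:
  fixes A :: "'a :: field mat"
  assumes m: "m \<ge> 1"
  shows "\<alpha> \<in> W1 n m A \<longleftrightarrow> \<alpha> \<in> carrier_vec m \<and>
    (\<forall>i<n. \<forall>t. block_row_sum n m A i *\<^sub>v (block_row_sum n m A 0 ^\<^sub>m t *\<^sub>v \<alpha>) =
       block_row_sum n m A 0 *\<^sub>v (block_row_sum n m A 0 ^\<^sub>m t *\<^sub>v \<alpha>))"
proof (cases "\<alpha> \<in> carrier_vec m")
  case \<alpha>: True
  let ?A = "block_row_sum n m A"
  have A: "?A i \<in> carrier_mat m m" for i by simp
  have pow: "?A 0 ^\<^sub>m t *\<^sub>v \<alpha> \<in> carrier_vec m" for t
    using mult_mat_vec_carrier[OF pow_carrier_mat[OF A] \<alpha>] .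
  have diff: "((?A i - ?A 0) * ?A 0 ^\<^sub>m t) *\<^sub>v \<alpha> = (?A i - ?A 0) *\<^sub>v (?A 0 ^\<^sub>m t *\<^sub>v \<alpha>)" for i t
    using assoc_mult_mat_vec[OF minus_carrier_mat[OF A] pow_carrier_mat[OF A] \<alpha>] .
  have zero_iff: "((?A i - ?A 0) * ?A 0 ^\<^sub>m t) *\<^sub>v \<alpha> = 0\<^sub>v m \<longleftrightarrow>
      ?A i *\<^sub>v (?A 0 ^\<^sub>m t *\<^sub>v \<alpha>) = ?A 0 *\<^sub>v (?A 0 ^\<^sub>m t *\<^sub>v \<alpha>)" for i t
  proof -
    let ?u = "?A i *\<^sub>v (?A 0 ^\<^sub>m t *\<^sub>v \<alpha>)" and ?v = "?A 0 *\<^sub>v (?A 0 ^\<^sub>m t *\<^sub>v \<alpha>)"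
    have uv: "?u \<in> carrier_vec m" "?v \<in> carrier_vec m"
      using mult_mat_vec_carrier[OF A pow] by blast+
    have "u - v = 0\<^sub>v m \<longleftrightarrow> u = v" if "u \<in> carrier_vec m" "v \<in> carrier_vec m" for u v :: "'a vec"
      using that by (auto simp: vec_eq_iff)
    from this[OF uv] have "?u - ?v = 0\<^sub>v m \<longleftrightarrow> ?u = ?v" .
    then show ?thesis unfolding diff minus_mult_distrib_mat_vec[OF A A pow] .
  qed
  have all_t: "(\<forall>t<m. ((?A i - ?A 0) * ?A 0 ^\<^sub>m t) *\<^sub>v \<alpha> = 0\<^sub>v m) \<longleftrightarrow>
      (\<forall>t. ((?A i - ?A 0) * ?A 0 ^\<^sub>m t) *\<^sub>v \<alpha> = 0\<^sub>v m)" for i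
  proof (intro iffI allI)
    fix t assume init: "\<forall>t<m. ((?A i - ?A 0) * ?A 0 ^\<^sub>m t) *\<^sub>v \<alpha> = 0\<^sub>v m"
    have E: "?A i - ?A 0 \<in> carrier_mat m m" by (rule minus_carrier_mat[OF A])
    have row_mult: "row M r \<bullet> v = (M *\<^sub>v v) $ r"
      if "M \<in> carrier_mat m m" "r < m" for M :: "'a mat" and r v
      using that by simp
    have "row (?A i - ?A 0) r \<bullet> (?A 0 ^\<^sub>m t *\<^sub>v \<alpha>) = 0" if r: "r < m" for r t
    proof (rule krylov_functional_zero[OF A _ \<alpha>])
      fix t assume "t < m"
      then show "row (?A i - ?A 0) r \<bullet> (?A 0 ^\<^sub>m t *\<^sub>v \<alpha>) = 0"
        using init unfolding row_mult[OF E r] diff by (simp add: r)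
    qed (use E r in auto)
    then show "((?A i - ?A 0) * ?A 0 ^\<^sub>m t) *\<^sub>v \<alpha> = 0\<^sub>v m"
      unfolding diff using E by (intro eq_vecI) auto
  qed auto
  have "\<alpha> \<in> W1 n m A \<longleftrightarrow> (\<forall>i\<in>{1..<n}. \<forall>t<m. ((?A i - ?A 0) * ?A 0 ^\<^sub>m t) *\<^sub>v \<alpha> = 0\<^sub>v m)"
    unfolding W1_def using \<alpha> m by auto
  also have "\<dots> \<longleftrightarrow> (\<forall>i\<in>{1..<n}. \<forall>t. ?A i *\<^sub>v (?A 0 ^\<^sub>m t *\<^sub>v \<alpha>) = ?A 0 *\<^sub>v (?A 0 ^\<^sub>m t *\<^sub>v \<alpha>))"
    by (simp only: all_t[unfolded zero_iff] zero_iff)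
  also have "\<dots> \<longleftrightarrow> (\<forall>i<n. \<forall>t. ?A i *\<^sub>v (?A 0 ^\<^sub>m t *\<^sub>v \<alpha>) = ?A 0 *\<^sub>v (?A 0 ^\<^sub>m t *\<^sub>v \<alpha>))"
    by (metis One_nat_def Suc_leI atLeastLessThan_iff gr0I)
  finally show ?thesis using \<alpha> by simp
qed (auto simp: W1_def)

lemma W1_invariant:
  fixes A :: "'a :: field mat"
  assumes m: "m \<ge> 1" and \<alpha>: "\<alpha> \<in> W1 n m A"
  shows "block_row_sum n m A 0 *\<^sub>v \<alpha> \<in> W1 n m A"
proof -
  let ?A = "block_row_sum n m A 0"
  have A: "?A \<in> carrier_mat m m" and \<alpha>': "\<alpha> \<in> carrier_vec m" using \<alpha> by (auto simp: W1_def)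
  have shift: "?A ^\<^sub>m t *\<^sub>v (?A *\<^sub>v \<alpha>) = ?A ^\<^sub>m Suc t *\<^sub>v \<alpha>" for t
    by (simp only: pow_mat.simps assoc_mult_mat_vec[OF pow_carrier_mat[OF A] A \<alpha>'])
  show ?thesis
    using \<alpha> mult_mat_vec_carrier[OF A \<alpha>'] unfolding W1_iff[OF m] shift by blast
qed

lemma mult_kron_ones_W1:
  fixes A :: "'a :: field mat"
  assumes A: "A \<in> carrier_mat (n * m) (n * m)" and m: "m \<ge> 1" and \<alpha>: "\<alpha> \<in> W1 n m A"
  shows "A *\<^sub>v kron_vec (ones_vec n) \<alpha> = kron_vec (ones_vec n) (block_row_sum n m A 0 *\<^sub>v \<alpha>)"
proof (rule mult_kron_ones[OF A])
  show \<alpha>': "\<alpha> \<in> carrier_vec m" using \<alpha> by (simp add: W1_def)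
  show "block_row_sum n m A 0 *\<^sub>v \<alpha> \<in> carrier_vec m"
    using mult_mat_vec_carrier[OF block_row_sum_carrier \<alpha>'] .
  fix i assume i: "i < n"
  have "block_row_sum n m A i *\<^sub>v (block_row_sum n m A 0 ^\<^sub>m 0 *\<^sub>v \<alpha>) =
      block_row_sum n m A 0 *\<^sub>v (block_row_sum n m A 0 ^\<^sub>m 0 *\<^sub>v \<alpha>)"
    using \<alpha> i unfolding W1_iff[OF m] by blast
  then show "block_row_sum n m A i *\<^sub>v \<alpha> = block_row_sum n m A 0 *\<^sub>v \<alpha>"
    using \<alpha>' by (simp add: block_row_sum_def)
qed

lemma W_invariant:
  fixes A :: "'a :: field mat"
  assumes A: "A \<in> carrier_mat (n * m) (n * m)" and m: "m \<ge> 1" and y: "y \<in> W n m A"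
  shows "A *\<^sub>v y \<in> W n m A"
  using y mult_kron_ones_W1[OF A m] W1_invariant[OF m] unfolding W_def by blast

lemma submodule_W1:
  fixes A :: "'a :: field mat"
  shows "submodule class_ring (W1 n m A) (module_vec TYPE('a) m)"
proof -
  interpret vec_space "TYPE('a)" m .
  let ?M = "\<lambda>i t. (block_row_sum n m A i - block_row_sum n m A 0) * block_row_sum n m A 0 ^\<^sub>m t"
  have M: "?M i t \<in> carrier_mat m m" for i t
    by (rule mult_carrier_mat[of _ m m]) (intro minus_carrier_mat pow_carrier_mat block_row_sum_carrier)+
  show ?thesis
  proof
    show "W1 n m A \<subseteq> carrier V" by (auto simp: W1_def)
    have "?M i t *\<^sub>v 0\<^sub>v m = 0\<^sub>v m" for i t by (rule mult_mat_zero_vec[OF M])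
    then show "\<zero>\<^bsub>V\<^esub> \<in> W1 n m A" by (simp add: W1_def)
    fix v w assume vw: "v \<in> W1 n m A" "w \<in> W1 n m A"
    then show "v \<oplus>\<^bsub>V\<^esub> w \<in> W1 n m A"
      using mult_add_distrib_mat_vec[OF M] by (simp add: W1_def)
  next
    fix c :: 'a and v assume "v \<in> W1 n m A"
    then show "c \<odot>\<^bsub>V\<^esub> v \<in> W1 n m A"
      using mult_mat_vec[OF M] by (simp add: W1_def)
  qed
qed


section \<open>Synchronization\<close>

text \<open>
  \<open>W\<close> consists of exactly those states in which the agents agree now and at all later times; it is
  invariant, so a trajectory synchronizes as soon as it enters \<open>W\<close>.
\<close>

theorem achieves_synchronization_iff:
  fixes A :: "'a :: field mat"
  assumes n: "n \<ge> 1" and m: "m \<ge> 1" and A: "A \<in> carrier_mat (n * m) (n * m)"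
  shows "achieves_synchronization n m A \<longleftrightarrow>
    (\<forall>x \<in> carrier_vec (n * m). \<exists>T. A ^\<^sub>m T *\<^sub>v x \<in> W n m A)"
proof
  assume sync: "achieves_synchronization n m A"
  show "\<forall>x \<in> carrier_vec (n * m). \<exists>T. A ^\<^sub>m T *\<^sub>v x \<in> W n m A"
  proof
    fix x :: "'a vec" assume x: "x \<in> carrier_vec (n * m)"
    let ?X = "\<lambda>t. A ^\<^sub>m t *\<^sub>v x"
    let ?A = "block_row_sum n m A"
    have X: "?X t \<in> carrier_vec (n * m)" for t
      using mult_mat_vec_carrier[OF pow_carrier_mat[OF A] x] .
    have "\<exists>T\<ge>1. \<forall>t\<ge>T. \<forall>i<n. \<forall>j<n. agent m (?X t) i = agent m (?X t) j"
      using X[of 0] pow_mat_Suc_mult_vec[OF A x]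
      by (intro sync[unfolded achieves_synchronization_def, rule_format] conjI allI)
    then obtain T where T: "\<And>t i j. t \<ge> T \<Longrightarrow> i < n \<Longrightarrow> j < n \<Longrightarrow> agent m (?X t) i = agent m (?X t) j"
      by blast
    have "\<exists>\<beta> \<in> carrier_vec m. ?X T = kron_vec (ones_vec n) \<beta>"
      using agents_agree_iff_kron_ones[OF X[of T] n] T[of T] by blast
    then obtain \<alpha> where \<alpha>: "\<alpha> \<in> carrier_vec m" "?X T = kron_vec (ones_vec n) \<alpha>" by blast
    \<comment> \<open>After time \<open>T\<close> the common state follows the first block row sum; agreement at the next instant
      forces all block row sums to act on it alike, which is membership in \<open>W1\<close>.\<close>
    define \<beta> where "\<beta> s = ?A 0 ^\<^sub>m s *\<^sub>v \<alpha>" for s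
    have \<beta>: "\<beta> s \<in> carrier_vec m" for s
      unfolding \<beta>_def by (rule mult_mat_vec_carrier[OF pow_carrier_mat[OF block_row_sum_carrier] \<alpha>(1)])
    have agree: "?A i *\<^sub>v \<beta> s = ?A 0 *\<^sub>v \<beta> s" if "?X (T + s) = kron_vec (ones_vec n) (\<beta> s)" "i < n" for s i
    proof -
      have "A *\<^sub>v kron_vec (ones_vec n) (\<beta> s) = ?X (Suc (T + s))"
        by (simp only: that(1) pow_mat_Suc_mult_vec[OF A x])
      then have "agent m (A *\<^sub>v kron_vec (ones_vec n) (\<beta> s)) i = agent m (A *\<^sub>v kron_vec (ones_vec n) (\<beta> s)) 0"
        using T[of "Suc (T + s)" i 0] that(2) n by (simp del: pow_mat.simps)
      then show ?thesis using agent_mult_kron_ones[OF A \<beta>] that(2) n by simp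
    qed
    have X_eq: "?X (T + s) = kron_vec (ones_vec n) (\<beta> s)" for s
    proof (induction s)
      case 0
      then show ?case using \<alpha> by (simp add: \<beta>_def block_row_sum_def)
    next
      case (Suc s)
      have "?X (T + Suc s) = A *\<^sub>v kron_vec (ones_vec n) (\<beta> s)"
        using pow_mat_Suc_mult_vec[OF A x, of "T + s"] Suc by (simp only: add_Suc_right)
      also have "\<dots> = kron_vec (ones_vec n) (?A 0 *\<^sub>v \<beta> s)"
        by (rule mult_kron_ones[OF A \<beta> agree[OF Suc]
              mult_mat_vec_carrier[OF block_row_sum_carrier \<beta>]])
      also have "?A 0 *\<^sub>v \<beta> s = \<beta> (Suc s)"
        unfolding \<beta>_def using pow_mat_Suc_mult_vec[OF block_row_sum_carrier \<alpha>(1)] by (rule sym)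
      finally show ?case .
    qed
    have "\<alpha> \<in> W1 n m A"
      unfolding W1_iff[OF m] using \<alpha>(1) agree[OF X_eq] unfolding \<beta>_def by blast
    then show "\<exists>T. A ^\<^sub>m T *\<^sub>v x \<in> W n m A" using \<alpha>(2) unfolding W_def by blast
  qed
next
  assume reach: "\<forall>x \<in> carrier_vec (n * m). \<exists>T. A ^\<^sub>m T *\<^sub>v x \<in> W n m A"
  show "achieves_synchronization n m A"
    unfolding achieves_synchronization_def
  proof (intro allI impI, elim conjE)
    fix X :: "nat \<Rightarrow> 'a vec"
    assume X0: "X 0 \<in> carrier_vec (n * m)" and step: "\<forall>t. X (Suc t) = A *\<^sub>v X t"
    have X: "X t = A ^\<^sub>m t *\<^sub>v X 0" for t
    proof (induction t)
      case 0
      then show ?case using A X0 by simp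
    next
      case (Suc t)
      then show ?case by (simp only: step pow_mat_Suc_mult_vec[OF A X0])
    qed
    obtain T where "A ^\<^sub>m T *\<^sub>v X 0 \<in> W n m A" using reach X0 by blast
    then have T: "X T \<in> W n m A" by (simp only: X[of T])
    have in_W: "X t \<in> W n m A" if "t \<ge> T" for t
      using that
      by (induction t rule: dec_induct) (simp_all only: T step W_invariant[OF A m])
    have agree: "agent m (X t) i = agent m (X t) j" if le: "t \<ge> T" and ij: "i < n" "j < n" for t i j
    proof -
      obtain \<alpha> where "\<alpha> \<in> carrier_vec m" "X t = kron_vec (ones_vec n) \<alpha>"
        using in_W[OF le] unfolding W_def W1_def by blast
      then show ?thesis using ij by (simp add: agent_kron_ones)
    qed
    show "\<exists>T\<ge>1. \<forall>t\<ge>T. \<forall>i<n. \<forall>j<n. agent m (X t) i = agent m (X t) j"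
    proof (intro exI[of _ "max 1 T"] conjI allI impI)
      fix t i j assume "max 1 T \<le> t" "i < n" "j < n"
      then show "agent m (X t) i = agent m (X t) j" by (intro agree) simp_all
    qed simp
  qed
qed

theorem theorem3p2:
  fixes n m d :: nat
    and A Q :: "'p :: prime_card mod_ring mat"
    and \<alpha>s :: "'p mod_ring vec list"
  assumes "n \<ge> 1" and "m \<ge> 1"
    and "A \<in> carrier_mat (n * m) (n * m)"
    and "d = subspace_dim (n * m) (W n m A)"
    and "ordered_basis m (W1 n m A) \<alpha>s"
    and "Q \<in> carrier_mat d d"
    and "block_row_sum n m A 0 * mat_of_cols m \<alpha>s = mat_of_cols m \<alpha>s * Q"
  shows "achieves_synchronization n m A \<longleftrightarrow>
           char_poly A = [:0, 1:] ^ (n * m - d) * char_poly Q"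
proof -
  let ?N = "n * m" and ?A0 = "block_row_sum n m A 0"
  let ?E = "kron_ones_mat n m :: 'p mod_ring mat"
  let ?f = "\<lambda>v. ?E *\<^sub>v v"
  let ?us = "map ?f \<alpha>s"
  note A = assms(3) and A0 = block_row_sum_carrier[of n m A 0]
  have E: "?E \<in> carrier_mat ?N m" unfolding kron_ones_mat_def by (rule mat_carrier)
  have inj: "inj_on ?f (carrier_vec m)"
  proof (rule inj_onI)
    fix v w :: "'p mod_ring vec"
    assume v: "v \<in> carrier_vec m" and w: "w \<in> carrier_vec m" and "?E *\<^sub>v v = ?E *\<^sub>v w"
    then have "agent m (kron_vec (ones_vec n) v) 0 = agent m (kron_vec (ones_vec n) w) 0"
      by (simp only: kron_ones_mat_mult_vec)
    then show "v = w" using v w assms(1) by (simp add: agent_kron_ones)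
  qed
  have W1_carrier: "W1 n m A \<subseteq> carrier_vec m" by (auto simp: W1_def)
  have W_image: "?f ` W1 n m A = W n m A"
    unfolding W_def Setcompr_eq_image using W1_carrier
    by (intro image_cong refl kron_ones_mat_mult_vec) blast
  note image = injective_image_of_basis[OF E inj submodule_W1 assms(5), unfolded W_image]
  have d: "length \<alpha>s = d" using image(4) assms(4) by simp
  have \<alpha>s: "set \<alpha>s \<subseteq> carrier_vec m" using image(1) W1_carrier by blast
  then have us: "set ?us \<subseteq> carrier_vec ?N" using mult_mat_vec_carrier[OF E] by auto
  have A0\<alpha>s: "set (map (\<lambda>v. ?A0 *\<^sub>v v) \<alpha>s) \<subseteq> carrier_vec m"
    using \<alpha>s mult_mat_vec_carrier[OF A0] by auto
  have M: "mat_of_cols m \<alpha>s \<in> carrier_mat m d" using mat_of_cols_carrier(1)[of m \<alpha>s] d by simp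

  \<comment> \<open>The relation defining \<open>Q\<close> is transported from \<open>\<alpha>s\<close> to the basis \<open>?us\<close> of \<open>W\<close>.\<close>
  have "A * mat_of_cols ?N ?us = mat_of_cols ?N (map (\<lambda>v. A *\<^sub>v v) ?us)"
    by (rule mat_of_cols_map_mult_vec[OF A us, symmetric])
  also have "map (\<lambda>v. A *\<^sub>v v) ?us = map ?f (map (\<lambda>v. ?A0 *\<^sub>v v) \<alpha>s)"
  proof -
    have "A *\<^sub>v (?E *\<^sub>v \<alpha>) = ?E *\<^sub>v (?A0 *\<^sub>v \<alpha>)" if "\<alpha> \<in> set \<alpha>s" for \<alpha>
    proof -
      have \<alpha>: "\<alpha> \<in> W1 n m A" "\<alpha> \<in> carrier_vec m" using that image(1) \<alpha>s by blast+
      show ?thesis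
        unfolding kron_ones_mat_mult_vec[OF \<alpha>(2)]
          kron_ones_mat_mult_vec[OF mult_mat_vec_carrier[OF A0 \<alpha>(2)]]
        by (rule mult_kron_ones_W1[OF A assms(2) \<alpha>(1)])
    qed
    then show ?thesis unfolding map_map comp_def by (intro map_cong refl)
  qed
  also have "mat_of_cols ?N (map ?f (map (\<lambda>v. ?A0 *\<^sub>v v) \<alpha>s)) = ?E * (?A0 * mat_of_cols m \<alpha>s)"
    by (simp only: mat_of_cols_map_mult_vec[OF E A0\<alpha>s] mat_of_cols_map_mult_vec[OF A0 \<alpha>s])
  also have "\<dots> = mat_of_cols ?N ?us * Q"
    unfolding assms(7) mat_of_cols_map_mult_vec[OF E \<alpha>s] by (rule assoc_mult_mat[OF E M assms(6), symmetric])
  finally have AU: "A * mat_of_cols ?N ?us = mat_of_cols ?N ?us * Q" .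

  let ?k = "?N - d"
  have len_us: "length ?us = d" using d by simp
  obtain S V D where S: "S \<in> carrier_mat ?k ?N" and V: "V \<in> carrier_mat ?N ?k"
    and D: "D \<in> carrier_mat ?k ?k" and SV: "S * V = 1\<^sub>m ?k" and SA: "S * A = D * S"
    and char: "char_poly A = char_poly Q * char_poly D"
    and ker: "\<forall>y \<in> carrier_vec ?N.
      S *\<^sub>v y = 0\<^sub>v ?k \<longleftrightarrow> (\<exists>c \<in> carrier_vec d. y = mat_of_cols ?N ?us *\<^sub>v c)"
    by (rule invariant_subspace_quotient[OF A us image(2) image(3) len_us assms(6) AU]) (rule that)
  have W_iff: "y \<in> W n m A \<longleftrightarrow> S *\<^sub>v y = 0\<^sub>v ?k" if "y \<in> carrier_vec ?N" for y
    unfolding ker[rule_format, OF that] image(5) d by blast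

  have "achieves_synchronization n m A \<longleftrightarrow> (\<forall>x \<in> carrier_vec ?N. \<exists>T. A ^\<^sub>m T *\<^sub>v x \<in> W n m A)"
    by (rule achieves_synchronization_iff[OF assms(1,2) A])
  also have "\<dots> \<longleftrightarrow> (\<forall>x \<in> carrier_vec ?N. \<exists>T. D ^\<^sub>m T *\<^sub>v (S *\<^sub>v x) = 0\<^sub>v ?k)"
    by (intro ball_cong ex_cong1 refl)
      (simp only: W_iff[OF mult_mat_vec_carrier[OF pow_carrier_mat[OF A]]]
        intertwining_pow_mult_vec[OF A D S SA])
  also have "\<dots> \<longleftrightarrow> (\<forall>z \<in> carrier_vec ?k. \<exists>T. D ^\<^sub>m T *\<^sub>v z = 0\<^sub>v ?k)"
  proof (intro iffI ballI)
    fix z :: "'p mod_ring vec"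
    assume hit: "\<forall>x \<in> carrier_vec ?N. \<exists>T. D ^\<^sub>m T *\<^sub>v (S *\<^sub>v x) = 0\<^sub>v ?k" and z: "z \<in> carrier_vec ?k"
    have "S *\<^sub>v (V *\<^sub>v z) = z"
      unfolding assoc_mult_mat_vec[OF S V z, symmetric] SV by (rule one_mult_mat_vec[OF z])
    then show "\<exists>T. D ^\<^sub>m T *\<^sub>v z = 0\<^sub>v ?k"
      using hit[rule_format, OF mult_mat_vec_carrier[OF V z]] by (simp only:)
  qed (use mult_mat_vec_carrier[OF S] in blast)
  also have "\<dots> \<longleftrightarrow> char_poly D = [:0, 1:] ^ ?k"
    unfolding char_poly_X_power_iff_nilpotent[OF D] nilpotent_iff_kills_each_vector[OF D] ..
  also have "\<dots> \<longleftrightarrow> char_poly A = [:0, 1:] ^ ?k * char_poly Q"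
  proof -
    have "char_poly Q \<noteq> 0" using degree_monic_char_poly[OF assms(6)] by auto
    then have "char_poly D = p \<longleftrightarrow> char_poly Q * char_poly D = char_poly Q * p" for p
      by simp
    then show ?thesis unfolding char by (simp only: mult.commute[of _ "char_poly Q"])
  qed
  finally show ?thesis .
qed

end
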